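(* The following automorphisms of the $4$-ary rooted tree (with vertices indexed by finite sequences from $\{0,1,2,3\}$) $$\alpha=(0,1)(2,3),$$ $$\xi_1=\left(1,\ \alpha^{\xi_2^{-1}},\ \xi_2,\ \alpha^{\xi_2^{-1}}\xi_2\right)(0,2)(1,3),$$ $$\xi_2=\left(\xi_1,\ \xi_1,\ \xi_1,\ \alpha^{(1+\xi_1^{-1})\xi_2^{-1}}\xi_1\right)$$ generate a group $G$ isomorphic to the restricted wreath product $G_{2,2}=C_2\wr\mathbb Z^2$. In addition, $G$ is the state-closure of $\xi_1$ and $G$ is finite-state; indeed, $\xi_1$ has $12$ states.
   Context: An automorphism $g$ of the $4$-ary tree is written $g=(g_0,g_1,g_2,g_3)\sigma$, where $\sigma$ is the permutation of $\{0,1,2,3\}$ induced on the first level and $g$ maps the vertex $iw$ to $i^\sigma w^{g_i}$ (right actions; products are read from left to right). $\sigma$ is omitted if it is trivial, and a permutation $\sigma$ is identified with $(1,1,1,1)\sigma$. The recursive equations uniquely determine the automorphisms. Exponent notation: $g^h=h^{-1}gh$, so $\alpha^{\xi_2^{-1}}=\xi_2\alpha\xi_2^{-1}$; sums in exponents denote products, so $\alpha^{(1+\xi_1^{-1})\xi_2^{-1}}=\alpha^{\xi_2^{-1}}\,\alpha^{\xi_1^{-1}\xi_2^{-1}}$. The states of $g$ are $g$, the $g_i$, the states of the $g_i$, and so on (counted as distinct automorphisms, the identity included if it occurs). The state-closure of $g$ is the group generated by all states of $g$. A group of tree automorphisms is finite-state if each of its elements has finitely many states. The restricted wreath product $C_2\wr\mathbb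 Z^2$ is the semidirect product $\left(\bigoplus_{w\in\mathbb Z^2}C_2\right)\rtimes\mathbb Z^2$, with $\mathbb Z^2$ permuting the summands regularly. *)

theory Defs
  imports "HOL-Algebra.Algebra" "HOL-Library.Numeral_Type" "HOL-Combinatorics.Transposition"
begin

section \<open>Automorphisms of the 4-ary rooted tree\<close>

text \<open>Vertices are words over the four-element type \<^typ>\<open>4\<close> with elements \<open>0, 1, 2, 3\<close>;
  the root is the empty word.\<close>

type_synonym vertex = "4 list"

definition child :: "vertex \<Rightarrow> vertex \<Rightarrow> bool" where
  "child v w \<longleftrightarrow> (\<exists>i. w = v @ [i])"

text \<open>Automorphisms act from the right, so the product of \<open>g\<close> and \<open>h\<close> is first \<open>g\<close>, then \<open>h\<close>.\<close>

definition tree_Aut :: "(vertex \<Rightarrow> vertex) monoid" where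
  "tree_Aut = \<lparr>carrier = {g. bij g \<and> (\<forall>v w. child (g v) (g w) \<longleftrightarrow> child v w)},
               monoid.mult = (\<lambda>g h. h \<circ> g),
               one = id\<rparr>"

text \<open>The element $(g_0,g_1,g_2,g_3)\sigma$.\<close>

primrec wreath_elt ::
  "(vertex \<Rightarrow> vertex) \<Rightarrow> (vertex \<Rightarrow> vertex) \<Rightarrow> (vertex \<Rightarrow> vertex) \<Rightarrow> (vertex \<Rightarrow> vertex)
    \<Rightarrow> (4 \<Rightarrow> 4) \<Rightarrow> vertex \<Rightarrow> vertex"
where
  "wreath_elt g0 g1 g2 g3 \<sigma> [] = []"
| "wreath_elt g0 g1 g2 g3 \<sigma> (i # w) =
     \<sigma> i # (if i = 0 then g0 else if i = 1 then g1 else if i = 2 then g2 else g3) w"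

abbreviation rooted_perm :: "(4 \<Rightarrow> 4) \<Rightarrow> vertex \<Rightarrow> vertex" where
  "rooted_perm \<sigma> \<equiv> wreath_elt id id id id \<sigma>"

text \<open>Exponent notation: \<open>conj_by G g h\<close> is $g^h = h^{-1} g h$.\<close>

definition conj_by :: "('a, 'b) monoid_scheme \<Rightarrow> 'a \<Rightarrow> 'a \<Rightarrow> 'a" where
  "conj_by G g h = inv\<^bsub>G\<^esub> h \<otimes>\<^bsub>G\<^esub> g \<otimes>\<^bsub>G\<^esub> h"

definition state_at :: "(vertex \<Rightarrow> vertex) \<Rightarrow> 4 \<Rightarrow> vertex \<Rightarrow> vertex" where
  "state_at g i w = tl (g (i # w))"

inductive_set states :: "(vertex \<Rightarrow> vertex) \<Rightarrow> (vertex \<Rightarrow> vertex) set" for g where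
  self: "g \<in> states g"
| step: "h \<in> states g \<Longrightarrow> state_at h i \<in> states g"

definition state_closure :: "(vertex \<Rightarrow> vertex) \<Rightarrow> (vertex \<Rightarrow> vertex) monoid" where
  "state_closure g = subgroup_generated tree_Aut (states g)"

definition finite_state :: "(vertex \<Rightarrow> vertex) monoid \<Rightarrow> bool" where
  "finite_state G \<longleftrightarrow> (\<forall>g\<in>carrier G. finite (states g))"

section \<open>Restricted wreath products\<close>

definition semidirect_product ::
  "('a, 'c) monoid_scheme \<Rightarrow> ('b, 'd) monoid_scheme \<Rightarrow> ('b \<Rightarrow> 'a \<Rightarrow> 'a) \<Rightarrow> ('a \<times> 'b) monoid"
where
  "semidirect_product N H \<phi> =
     \<lparr>carrier = carrier N \<times> carrier H,
      monoid.mult = (\<lambda>(n, h) (n', h'). (n \<otimes>\<^bsub>N\<^esub> \<phi> h n', h \<otimes>\<^bsub>H\<^esub> h')),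
      one = (\<one>\<^bsub>N\<^esub>, \<one>\<^bsub>H\<^esub>)\<rparr>"

text \<open>\<open>H\<close> acts on the direct sum of copies of \<open>A\<close> indexed by \<open>H\<close> by moving the summand at \<open>x\<close>
  to the summand at \<open>h x\<close>.\<close>

definition restricted_wreath_product ::
  "('a, 'c) monoid_scheme \<Rightarrow> ('b, 'd) monoid_scheme \<Rightarrow> (('b \<Rightarrow> 'a) \<times> 'b) monoid"
where
  "restricted_wreath_product A H =
     semidirect_product (sum_group (carrier H) (\<lambda>_. A)) H
       (\<lambda>h f. \<lambda>x\<in>carrier H. f (inv\<^bsub>H\<^esub> h \<otimes>\<^bsub>H\<^esub> x))"

definition G_2_2 :: "((int \<times> int \<Rightarrow> int) \<times> (int \<times> int)) monoid" where
  "G_2_2 = restricted_wreath_product (integer_mod_group 2) (integer_group \<times>\<times> integer_group)"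

section \<open>Well-definedness\<close>

lemma child_length: "child v w \<Longrightarrow> length w = Suc (length v)"
  by (auto simp: child_def)

lemma child_snoc [simp]: "child v (v @ [i])"
  by (auto simp: child_def)

lemma not_child_Nil [simp]: "\<not> child v []"
  by (auto simp: child_def)

lemma child_Nil_iff: "child [] w \<longleftrightarrow> (\<exists>i. w = [i])"
  by (auto simp: child_def)

lemma child_Cons_iff: "child (i # v) (j # w) \<longleftrightarrow> i = j \<and> child v w"
  by (auto simp: child_def)

lemma not_Nil_is_child: "w \<noteq> [] \<Longrightarrow> \<exists>v. child v w"
  by (metis append_butlast_last_id child_snoc)

lemma tree_Aut_bij: "g \<in> carrier tree_Aut \<Longrightarrow> bij g"
  by (simp add: tree_Aut_def)

lemma tree_Aut_child:
  "g \<in> carrier tree_Aut \<Longrightarrow> child (g v) (g w) \<longleftrightarrow> child v w"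
  by (simp add: tree_Aut_def)

lemma tree_AutI:
  "bij g \<Longrightarrow> (\<And>v w. child (g v) (g w) \<longleftrightarrow> child v w) \<Longrightarrow> g \<in> carrier tree_Aut"
  by (simp add: tree_Aut_def)

lemma tree_Aut_mult: "g \<otimes>\<^bsub>tree_Aut\<^esub> h = h \<circ> g"
  by (simp add: tree_Aut_def)

lemma tree_Aut_one: "\<one>\<^bsub>tree_Aut\<^esub> = id"
  by (simp add: tree_Aut_def)

lemma tree_Aut_Nil:
  assumes "g \<in> carrier tree_Aut"
  shows "g [] = []"
proof (rule ccontr)
  assume "g [] \<noteq> []"
  then obtain v where "child v (g [])"
    using not_Nil_is_child by blast
  moreover obtain u where "v = g u"
    using tree_Aut_bij[OF assms] by (metis bij_pointE)
  ultimately show False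
    using tree_Aut_child[OF assms] by simp
qed

lemma tree_Aut_length:
  assumes "g \<in> carrier tree_Aut"
  shows "length (g w) = length w"
proof (induction w rule: rev_induct)
  case Nil
  then show ?case by (simp add: tree_Aut_Nil[OF assms])
next
  case (snoc i w)
  then show ?case
    using tree_Aut_child[OF assms, of w "w @ [i]"] child_length by force
qed

lemma group_tree_Aut: "group tree_Aut"
proof (rule groupI)
  fix g assume g: "g \<in> carrier tree_Aut"
  have b: "bij g" by (rule tree_Aut_bij[OF g])
  have "inv_into UNIV g \<in> carrier tree_Aut"
  proof (rule tree_AutI)
    show "bij (inv_into UNIV g)" using b by (rule bij_imp_bij_inv)
    show "child (inv_into UNIV g v) (inv_into UNIV g w) \<longleftrightarrow> child v w" for v w
      using tree_Aut_child[OF g, of "inv_into UNIV g v" "inv_into UNIV g w"] b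
      by (simp add: bij_is_surj surj_f_inv_f)
  qed
  moreover have "inv_into UNIV g \<otimes>\<^bsub>tree_Aut\<^esub> g = \<one>\<^bsub>tree_Aut\<^esub>"
    using b by (auto simp: tree_Aut_mult tree_Aut_one fun_eq_iff bij_is_surj surj_f_inv_f)
  ultimately show "\<exists>h\<in>carrier tree_Aut. h \<otimes>\<^bsub>tree_Aut\<^esub> g = \<one>\<^bsub>tree_Aut\<^esub>"
    by blast
qed (auto simp: tree_Aut_def bij_comp comp_assoc)

lemma tree_Aut_inv_apply:
  assumes "g \<in> carrier tree_Aut"
  shows "(inv\<^bsub>tree_Aut\<^esub> g) (g w) = w" "g ((inv\<^bsub>tree_Aut\<^esub> g) w) = w"
proof -
  interpret group tree_Aut by (rule group_tree_Aut)
  show "(inv\<^bsub>tree_Aut\<^esub> g) (g w) = w"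
    using r_inv[OF assms] by (simp add: tree_Aut_mult tree_Aut_one fun_eq_iff)
  show "g ((inv\<^bsub>tree_Aut\<^esub> g) w) = w"
    using l_inv[OF assms] by (simp add: tree_Aut_mult tree_Aut_one fun_eq_iff)
qed

lemma four_cases: "(i::4) = 0 \<or> i = 1 \<or> i = 2 \<or> i = 3"
proof (induct i)
  case (of_int z)
  then have "z = 0 \<or> z = 1 \<or> z = 2 \<or> z = 3" by auto
  then show ?case by auto
qed

lemma four_distinct [simp]:
  "(0::4) \<noteq> 1" "(0::4) \<noteq> 2" "(0::4) \<noteq> 3" "(1::4) \<noteq> 2" "(1::4) \<noteq> 3" "(2::4) \<noteq> 3"
  "(1::4) \<noteq> 0" "(2::4) \<noteq> 0" "(3::4) \<noteq> 0" "(2::4) \<noteq> 1" "(3::4) \<noteq> 1" "(3::4) \<noteq> 2"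
  by simp_all

lemma tree_Aut_Cons:
  assumes g: "g \<in> carrier tree_Aut"
  shows "g (i # w) = hd (g [i]) # state_at g i w"
proof -
  have "hd (g (i # w)) = hd (g [i])"
  proof (induction w rule: rev_induct)
    case (snoc j w)
    have "child (g (i # w)) (g (i # w @ [j]))"
      using tree_Aut_child[OF g] by (auto simp: child_def)
    moreover have "g (i # w) \<noteq> []"
      using tree_Aut_length[OF g, of "i # w"] by auto
    ultimately show ?case using snoc by (auto simp: child_def)
  qed simp
  moreover have "g (i # w) \<noteq> []"
    using tree_Aut_length[OF g, of "i # w"] by auto
  ultimately show ?thesis
    by (simp add: state_at_def) (metis list.collapse)
qed

lemma state_at_closed:
  assumes g: "g \<in> carrier tree_Aut"
  shows "state_at g i \<in> carrier tree_Aut"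
proof (rule tree_AutI)
  define p where "p j = hd (g [j])" for j
  have C: "g (j # w) = p j # state_at g j w" for j w
    unfolding p_def by (rule tree_Aut_Cons[OF g])
  have "inj (state_at g i)"
  proof (rule injI)
    fix v w assume "state_at g i v = state_at g i w"
    then have "g (i # v) = g (i # w)" by (simp add: C)
    then show "v = w"
      using bij_is_inj[OF tree_Aut_bij[OF g]] by (metis injD list.inject)
  qed
  moreover have "\<exists>v. state_at g i v = w" for w
  proof -
    have inj: "j = k" if "p j = p k" for j k
    proof -
      have "state_at g j [] = []" for j
        using tree_Aut_length[OF g, of "[j]"] by (simp add: C)
      then have "g [j] = g [k]" using that by (simp add: C)
      then show "j = k"
        using bij_is_inj[OF tree_Aut_bij[OF g]] by (metis injD list.inject)
    qed
    obtain u where u: "g u = p i # w"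
      using tree_Aut_bij[OF g] by (metis bij_pointE)
    then obtain j v where "u = j # v"
      using tree_Aut_Nil[OF g] by (cases u) auto
    with u have "p j = p i" "state_at g j v = w" by (auto simp: C)
    with inj show ?thesis by metis
  qed
  ultimately show "bij (state_at g i)" by (auto simp: bij_def surj_def) metis
  show "child (state_at g i v) (state_at g i w) \<longleftrightarrow> child v w" for v w
    using tree_Aut_child[OF g, of "i # v" "i # w"] by (simp add: C child_Cons_iff)
qed

lemma states_closed: "h \<in> states g \<Longrightarrow> g \<in> carrier tree_Aut \<Longrightarrow> h \<in> carrier tree_Aut"
  by (induction rule: states.induct) (auto intro: state_at_closed)

lemma wreath_elt_decomposition:
  assumes "g \<in> carrier tree_Aut"
  shows "g = wreath_elt (state_at g 0) (state_at g 1) (state_at g 2) (state_at g 3) (\<lambda>i. hd (g [i]))"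
proof
  fix w
  show "g w = wreath_elt (state_at g 0) (state_at g 1) (state_at g 2) (state_at g 3)
    (\<lambda>i. hd (g [i])) w"
  proof (cases w)
    case Nil
    then show ?thesis using tree_Aut_Nil[OF assms] by simp
  next
    case (Cons i v)
    then show ?thesis
      using four_cases[of i] by (subst Cons, subst tree_Aut_Cons[OF assms]) auto
  qed
qed

lemma wreath_elt_closed:
  assumes g: "g0 \<in> carrier tree_Aut" "g1 \<in> carrier tree_Aut" "g2 \<in> carrier tree_Aut"
    "g3 \<in> carrier tree_Aut" and s: "bij \<sigma>"
  shows "wreath_elt g0 g1 g2 g3 \<sigma> \<in> carrier tree_Aut"
proof -
  define c where "c i = (if i = (0::4) then g0 else if i = 1 then g1 else if i = 2 then g2 else g3)"
    for i
  let ?g = "wreath_elt g0 g1 g2 g3 \<sigma>"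
  have c: "c i \<in> carrier tree_Aut" for i using g by (simp add: c_def)
  have gC: "?g (i # w) = \<sigma> i # c i w" for i w by (simp add: c_def)
  have si: "\<sigma> i = \<sigma> j \<longleftrightarrow> i = j" for i j using s by (metis bij_is_inj injD)
  show ?thesis
  proof (rule tree_AutI)
    have "v = w" if "?g v = ?g w" for v w
      using that bij_is_inj[OF tree_Aut_bij[OF c]]
      by (cases v; cases w) (auto simp: gC si simp del: wreath_elt.simps(2) dest: injD)
    moreover have "\<exists>v. ?g v = w" for w
    proof (cases w)
      case Nil
      then have "?g [] = w" by simp
      then show ?thesis by blast
    next
      case (Cons i u)
      obtain j where j: "\<sigma> j = i" using s by (metis bij_pointE)
      obtain v where v: "c j v = u" using tree_Aut_bij[OF c] by (metis bij_pointE)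
      have "?g (j # v) = w" by (simp add: gC Cons j v del: wreath_elt.simps)
      then show ?thesis by blast
    qed
    ultimately show "bij ?g" by (auto simp: bij_def inj_def surj_def) metis
    show "child (?g v) (?g w) \<longleftrightarrow> child v w" for v w
    proof (cases w)
      case Nil
      then show ?thesis by simp
    next
      case w: (Cons j u)
      show ?thesis
      proof (cases v)
        case Nil
        have "c j u = [] \<longleftrightarrow> u = []"
          using tree_Aut_length[OF c, of j u] by (metis length_0_conv)
        then show ?thesis
          by (simp add: w Nil gC child_Nil_iff del: wreath_elt.simps(2))
      next
        case (Cons i t)
        then show ?thesis
          using tree_Aut_child[OF c]
          by (auto simp: w gC child_Cons_iff si simp del: wreath_elt.simps)
      qed
    qed
  qed
qed

text \<open>Agreement of two automorphisms on the levels up to \<open>n\<close>.\<close>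

definition agree :: "nat \<Rightarrow> (vertex \<Rightarrow> vertex) \<Rightarrow> (vertex \<Rightarrow> vertex) \<Rightarrow> bool" where
  "agree n g h \<longleftrightarrow> (\<forall>w. length w \<le> n \<longrightarrow> g w = h w)"

lemma agree_refl [simp]: "agree n g g"
  by (simp add: agree_def)

lemma agree_mult:
  assumes "g \<in> carrier tree_Aut" "agree n g g'" "agree n h h'"
  shows "agree n (g \<otimes>\<^bsub>tree_Aut\<^esub> h) (g' \<otimes>\<^bsub>tree_Aut\<^esub> h')"
  using assms tree_Aut_length[OF assms(1)] by (auto simp: agree_def tree_Aut_mult) metis

lemma agree_inv:
  assumes g: "g \<in> carrier tree_Aut" and h: "h \<in> carrier tree_Aut" and a: "agree n g h"
  shows "agree n (inv\<^bsub>tree_Aut\<^esub> g) (inv\<^bsub>tree_Aut\<^esub> h)"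
  unfolding agree_def
proof (intro allI impI)
  fix w :: vertex assume w: "length w \<le> n"
  let ?u = "(inv\<^bsub>tree_Aut\<^esub> g) w"
  have "length ?u = length w"
    using tree_Aut_length[OF g, of ?u] by (simp add: tree_Aut_inv_apply[OF g])
  then have "g ?u = h ?u" using a w by (simp add: agree_def)
  then have "h ?u = w" by (simp add: tree_Aut_inv_apply[OF g])
  then show "?u = (inv\<^bsub>tree_Aut\<^esub> h) w"
    using tree_Aut_inv_apply(1)[OF h, of ?u] by simp
qed

lemma agree_wreath_elt:
  assumes "agree n g0 h0" "agree n g1 h1" "agree n g2 h2" "agree n g3 h3"
  shows "agree (Suc n) (wreath_elt g0 g1 g2 g3 \<sigma>) (wreath_elt h0 h1 h2 h3 \<sigma>)"
  unfolding agree_def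
proof (intro allI impI)
  fix w :: vertex assume "length w \<le> Suc n"
  then show "wreath_elt g0 g1 g2 g3 \<sigma> w = wreath_elt h0 h1 h2 h3 \<sigma> w"
    using assms by (cases w) (auto simp: agree_def)
qed

lemma tree_Aut_limit:
  assumes s: "\<And>n. s n \<in> carrier tree_Aut" and a: "\<And>n. agree n (s n) (s (Suc n))"
  obtains g where "g \<in> carrier tree_Aut" "\<And>n. agree n g (s n)"
proof
  have st: "s (n + k) w = s n w" if "length w \<le> n" for n k w
  proof (induction k)
    case (Suc k)
    have "s (n + k) w = s (Suc (n + k)) w"
      using a[of "n + k"] that by (simp add: agree_def)
    then show ?case using Suc by simp
  qed simp
  define g where "g w = s (length w) w" for w
  have gs: "g w = s n w" if "length w \<le> n" for n w
    using st[of w "length w" "n - length w"] that by (simp add: g_def)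
  show "agree n g (s n)" for n using gs by (simp add: agree_def)
  show "g \<in> carrier tree_Aut"
  proof (rule tree_AutI)
    have "v = w" if "g v = g w" for v w
    proof -
      let ?n = "max (length v) (length w)"
      have "s ?n v = s ?n w" using that gs[of v ?n] gs[of w ?n] by simp
      then show ?thesis using bij_is_inj[OF tree_Aut_bij[OF s]] by (metis injD)
    qed
    moreover have "\<exists>v. g v = w" for w
    proof -
      obtain v where v: "s (length w) v = w"
        using tree_Aut_bij[OF s] by (metis bij_pointE)
      then have "length v = length w" using tree_Aut_length[OF s] by metis
      then show ?thesis using v gs[of v "length w"] by auto
    qed
    ultimately show "bij g" by (auto simp: bij_def inj_def surj_def) metis
    show "child (g v) (g w) \<longleftrightarrow> child v w" for v w
      using tree_Aut_child[OF s, of "max (length v) (length w)" v w]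
        gs[of v "max (length v) (length w)"] gs[of w "max (length v) (length w)"] by simp
  qed
qed

lemma agree_all: "(\<And>n. agree n g h) \<Longrightarrow> g = h"
  by (auto simp: agree_def)

lemma rooted_perm_closed: "bij \<sigma> \<Longrightarrow> rooted_perm \<sigma> \<in> carrier tree_Aut"
  using group.is_monoid[OF group_tree_Aut, THEN monoid.one_closed]
  by (intro wreath_elt_closed) (auto simp: tree_Aut_one)

text \<open>The recursive equations have a solution, and only one.\<close>

theorem recursive_equations_unique_solution:
  fixes \<alpha> :: "vertex \<Rightarrow> vertex"
  assumes \<alpha>: "\<alpha> = rooted_perm (transpose 0 1 \<circ> transpose 2 3)"
  shows "\<alpha> \<in> carrier tree_Aut"
    and "\<exists>!(\<xi>\<^sub>1, \<xi>\<^sub>2). \<xi>\<^sub>1 \<in> carrier tree_Aut \<and> \<xi>\<^sub>2 \<in> carrier tree_Aut \<and>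
      \<xi>\<^sub>1 = wreath_elt \<one>\<^bsub>tree_Aut\<^esub>
                       (conj_by tree_Aut \<alpha> (inv\<^bsub>tree_Aut\<^esub> \<xi>\<^sub>2))
                       \<xi>\<^sub>2
                       (conj_by tree_Aut \<alpha> (inv\<^bsub>tree_Aut\<^esub> \<xi>\<^sub>2) \<otimes>\<^bsub>tree_Aut\<^esub> \<xi>\<^sub>2)
                       (transpose 0 2 \<circ> transpose 1 3) \<and>
      \<xi>\<^sub>2 = wreath_elt \<xi>\<^sub>1
                       \<xi>\<^sub>1
                       \<xi>\<^sub>1
                       (conj_by tree_Aut \<alpha> (inv\<^bsub>tree_Aut\<^esub> \<xi>\<^sub>2)
                         \<otimes>\<^bsub>tree_Aut\<^esub> conj_by tree_Aut \<alpha> (inv\<^bsub>tree_Aut\<^esub> \<xi>\<^sub>1 \<otimes>\<^bsub>tree_Aut\<^esub> inv\<^bsub>tree_Aut\<^esub> \<xi>\<^sub>2)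
                         \<otimes>\<^bsub>tree_Aut\<^esub> \<xi>\<^sub>1)
                       id"
proof -
  interpret group tree_Aut by (rule group_tree_Aut)
  let ?C = "carrier tree_Aut"
  define F1 where "F1 y = wreath_elt \<one>\<^bsub>tree_Aut\<^esub>
                       (conj_by tree_Aut \<alpha> (inv\<^bsub>tree_Aut\<^esub> y)) y
                       (conj_by tree_Aut \<alpha> (inv\<^bsub>tree_Aut\<^esub> y) \<otimes>\<^bsub>tree_Aut\<^esub> y)
                       (transpose 0 2 \<circ> transpose 1 3)" for y
  define F2 where "F2 x y = wreath_elt x x x
                       (conj_by tree_Aut \<alpha> (inv\<^bsub>tree_Aut\<^esub> y)
                         \<otimes>\<^bsub>tree_Aut\<^esub> conj_by tree_Aut \<alpha> (inv\<^bsub>tree_Aut\<^esub> x \<otimes>\<^bsub>tree_Aut\<^esub> inv\<^bsub>tree_Aut\<^esub> y)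
                         \<otimes>\<^bsub>tree_Aut\<^esub> x) id" for x y
  show \<alpha>C: "\<alpha> \<in> ?C"
    unfolding \<alpha> by (intro rooted_perm_closed bij_comp) auto
  have F1C: "F1 y \<in> ?C" if "y \<in> ?C" for y
    unfolding F1_def conj_by_def using that \<alpha>C
    by (intro wreath_elt_closed bij_comp m_closed inv_closed one_closed) auto
  have F2C: "F2 x y \<in> ?C" if "x \<in> ?C" "y \<in> ?C" for x y
    unfolding F2_def conj_by_def using that \<alpha>C
    by (intro wreath_elt_closed m_closed inv_closed) auto
  have F1a: "agree (Suc n) (F1 y) (F1 y')" if "y \<in> ?C" "y' \<in> ?C" "agree n y y'" for n y y'
    unfolding F1_def conj_by_def using that \<alpha>C
    by (intro agree_wreath_elt agree_mult agree_inv inv_closed m_closed agree_refl) auto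
  have F2a: "agree (Suc n) (F2 x y) (F2 x' y')"
    if "x \<in> ?C" "x' \<in> ?C" "y \<in> ?C" "y' \<in> ?C" "agree n x x'" "agree n y y'" for n x x' y y'
    unfolding F2_def conj_by_def using that \<alpha>C
    by (intro agree_wreath_elt agree_mult agree_inv inv_closed m_closed agree_refl) auto
  define s where "s n = ((\<lambda>(x, y). (F1 y, F2 x y)) ^^ n) (id, id)" for n
  define u where "u n = fst (s n)" for n
  define z where "z n = snd (s n)" for n
  have rec: "u (Suc n) = F1 (z n)" "z (Suc n) = F2 (u n) (z n)" for n
    by (simp_all add: u_def z_def s_def case_prod_beta)
  have "u n \<in> ?C \<and> z n \<in> ?C" for n
  proof (induction n)
    case 0
    show ?case using one_closed by (simp add: u_def z_def s_def tree_Aut_one flip: id_def)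
  qed (simp add: rec F1C F2C)
  then have uC: "u n \<in> ?C" and zC: "z n \<in> ?C" for n by auto
  have ag: "agree n (u n) (u (Suc n)) \<and> agree n (z n) (z (Suc n))" for n
  proof (induction n)
    case 0
    show ?case
      using tree_Aut_Nil[OF uC] tree_Aut_Nil[OF zC] by (simp add: agree_def)
  next
    case (Suc n)
    then show ?case
      by (subst (1 2) rec(1), subst (1 2) rec(2)) (intro conjI F1a F2a uC zC; simp)
  qed
  obtain a where a: "a \<in> ?C" "\<And>n. agree n a (u n)"
    using tree_Aut_limit[of u] uC ag by metis
  obtain b where b: "b \<in> ?C" "\<And>n. agree n b (z n)"
    using tree_Aut_limit[of z] zC ag by metis
  have "a = F1 b"
  proof (rule agree_all)
    fix n
    show "agree n a (F1 b)"
      using F1a[OF b(1) zC b(2), of n] a(2)[of "Suc n"] by (simp add: rec agree_def)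
  qed
  moreover have "b = F2 a b"
  proof (rule agree_all)
    fix n
    show "agree n b (F2 a b)"
      using F2a[OF a(1) uC b(1) zC a(2) b(2), of n] b(2)[of "Suc n"] by (simp add: rec agree_def)
  qed
  moreover have "a' = a \<and> b' = b"
    if "a' \<in> ?C" "b' \<in> ?C" "a' = F1 b'" "b' = F2 a' b'" for a' b'
  proof -
    have "agree n a' a \<and> agree n b' b" for n
    proof (induction n)
      case 0
      show ?case
        using that(1,2) a(1) b(1) by (simp add: agree_def tree_Aut_Nil)
    next
      case (Suc n)
      have "agree (Suc n) a' a"
        using Suc by (subst that(3), subst \<open>a = F1 b\<close>) (intro F1a that b, simp)
      moreover have "agree (Suc n) b' b"
        using Suc by (subst that(4), subst \<open>b = F2 a b\<close>) (intro F2a that a b; simp)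
      ultimately show ?case ..
    qed
    then show ?thesis using agree_all by blast
  qed
  ultimately have "\<exists>!p. fst p \<in> ?C \<and> snd p \<in> ?C \<and> fst p = F1 (snd p) \<and> snd p = F2 (fst p) (snd p)"
    using a(1) b(1) by (metis (no_types, lifting) fst_conv snd_conv prod_eq_iff)
  then show "\<exists>!(\<xi>\<^sub>1, \<xi>\<^sub>2). \<xi>\<^sub>1 \<in> carrier tree_Aut \<and> \<xi>\<^sub>2 \<in> carrier tree_Aut \<and>
      \<xi>\<^sub>1 = wreath_elt \<one>\<^bsub>tree_Aut\<^esub>
                       (conj_by tree_Aut \<alpha> (inv\<^bsub>tree_Aut\<^esub> \<xi>\<^sub>2))
                       \<xi>\<^sub>2
                       (conj_by tree_Aut \<alpha> (inv\<^bsub>tree_Aut\<^esub> \<xi>\<^sub>2) \<otimes>\<^bsub>tree_Aut\<^esub> \<xi>\<^sub>2)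
                       (transpose 0 2 \<circ> transpose 1 3) \<and>
      \<xi>\<^sub>2 = wreath_elt \<xi>\<^sub>1
                       \<xi>\<^sub>1
                       \<xi>\<^sub>1
                       (conj_by tree_Aut \<alpha> (inv\<^bsub>tree_Aut\<^esub> \<xi>\<^sub>2)
                         \<otimes>\<^bsub>tree_Aut\<^esub> conj_by tree_Aut \<alpha> (inv\<^bsub>tree_Aut\<^esub> \<xi>\<^sub>1 \<otimes>\<^bsub>tree_Aut\<^esub> inv\<^bsub>tree_Aut\<^esub> \<xi>\<^sub>2)
                         \<otimes>\<^bsub>tree_Aut\<^esub> \<xi>\<^sub>1)
                       id"
    unfolding F1_def F2_def case_prod_beta .
qed

lemma group_restricted_wreath_product:
  assumes A: "group A" and H: "group H"
  shows "group (restricted_wreath_product A H)"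
proof -
  interpret A: group A by (rule A)
  interpret H: group H by (rule H)
  let ?N = "sum_group (carrier H) (\<lambda>_. A)"
  interpret N: group ?N using A by simp
  define \<phi> where "\<phi> h f = (\<lambda>x\<in>carrier H. f (inv\<^bsub>H\<^esub> h \<otimes>\<^bsub>H\<^esub> x))" for h and f :: "'c \<Rightarrow> 'a"
  have carr: "f \<in> carrier ?N \<longleftrightarrow>
      f \<in> carrier H \<rightarrow>\<^sub>E carrier A \<and> finite {x \<in> carrier H. f x \<noteq> \<one>\<^bsub>A\<^esub>}" for f
    using A by (auto simp: carrier_sum_group)
  have mult: "f \<otimes>\<^bsub>?N\<^esub> g = (\<lambda>x\<in>carrier H. f x \<otimes>\<^bsub>A\<^esub> g x)" for f g by simp
  have \<phi>C: "\<phi> h f \<in> carrier ?N" if h: "h \<in> carrier H" and f: "f \<in> carrier ?N" for h f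
  proof -
    have "{x \<in> carrier H. \<phi> h f x \<noteq> \<one>\<^bsub>A\<^esub>} \<subseteq>
        (\<lambda>x. h \<otimes>\<^bsub>H\<^esub> x) ` {x \<in> carrier H. f x \<noteq> \<one>\<^bsub>A\<^esub>}"
    proof
      fix x assume "x \<in> {x \<in> carrier H. \<phi> h f x \<noteq> \<one>\<^bsub>A\<^esub>}"
      then have x: "x \<in> carrier H" "f (inv\<^bsub>H\<^esub> h \<otimes>\<^bsub>H\<^esub> x) \<noteq> \<one>\<^bsub>A\<^esub>" by (auto simp: \<phi>_def)
      then have "x = h \<otimes>\<^bsub>H\<^esub> (inv\<^bsub>H\<^esub> h \<otimes>\<^bsub>H\<^esub> x)" using h by (simp add: H.m_assoc[symmetric])
      then show "x \<in> (\<lambda>x. h \<otimes>\<^bsub>H\<^esub> x) ` {x \<in> carrier H. f x \<noteq> \<one>\<^bsub>A\<^esub>}" using x h by blast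
    qed
    moreover have "finite ((\<lambda>x. h \<otimes>\<^bsub>H\<^esub> x) ` {x \<in> carrier H. f x \<noteq> \<one>\<^bsub>A\<^esub>})"
      using f unfolding carr by simp
    ultimately have "finite {x \<in> carrier H. \<phi> h f x \<noteq> \<one>\<^bsub>A\<^esub>}"
      by (rule finite_subset)
    moreover have "\<phi> h f \<in> carrier H \<rightarrow>\<^sub>E carrier A"
      using f h unfolding carr by (auto simp: \<phi>_def)
    ultimately show ?thesis unfolding carr by blast
  qed
  have \<phi>m: "\<phi> h (f \<otimes>\<^bsub>?N\<^esub> g) = \<phi> h f \<otimes>\<^bsub>?N\<^esub> \<phi> h g" if "h \<in> carrier H" for h f g
    using that by (auto simp: \<phi>_def)
  have \<phi>\<phi>: "\<phi> h (\<phi> k f) = \<phi> (h \<otimes>\<^bsub>H\<^esub> k) f" if "h \<in> carrier H" "k \<in> carrier H" for h k f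
    using that by (auto simp: \<phi>_def H.inv_mult_group H.m_assoc)
  have \<phi>1: "\<phi> \<one>\<^bsub>H\<^esub> f = f" if "f \<in> carrier ?N" for f
  proof -
    have f: "f \<in> carrier H \<rightarrow>\<^sub>E carrier A" using that unfolding carr by blast
    have "\<phi> \<one>\<^bsub>H\<^esub> f = restrict f (carrier H)"
      unfolding \<phi>_def by (rule restrict_ext) simp
    then show ?thesis using PiE_restrict[OF f] by simp
  qed
  have \<phi>one: "\<phi> h \<one>\<^bsub>?N\<^esub> = \<one>\<^bsub>?N\<^esub>" if "h \<in> carrier H" for h
    using that by (auto simp: \<phi>_def)
  have W: "restricted_wreath_product A H = semidirect_product ?N H \<phi>"
    unfolding restricted_wreath_product_def \<phi>_def ..
  note [simp del] = mult_sum_group one_sum_group carrier_sum_group inv_sum_group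
  show ?thesis
    unfolding W
  proof (rule groupI)
    fix p assume "p \<in> carrier (semidirect_product ?N H \<phi>)"
    then obtain n h where p: "p = (n, h)" and n: "n \<in> carrier ?N" and h: "h \<in> carrier H"
      by (auto simp: semidirect_product_def)
    let ?q = "(\<phi> (inv\<^bsub>H\<^esub> h) (inv\<^bsub>?N\<^esub> n), inv\<^bsub>H\<^esub> h)"
    have "\<phi> (inv\<^bsub>H\<^esub> h) (inv\<^bsub>?N\<^esub> n) \<otimes>\<^bsub>?N\<^esub> \<phi> (inv\<^bsub>H\<^esub> h) n = \<one>\<^bsub>?N\<^esub>"
      using n h by (simp add: \<phi>m[symmetric] \<phi>one N.l_inv)
    then have "?q \<otimes>\<^bsub>semidirect_product ?N H \<phi>\<^esub> p = \<one>\<^bsub>semidirect_product ?N H \<phi>\<^esub>"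
      using n h by (simp add: p semidirect_product_def)
    moreover have "?q \<in> carrier (semidirect_product ?N H \<phi>)"
      using n h \<phi>C by (simp add: semidirect_product_def)
    ultimately show "\<exists>q\<in>carrier (semidirect_product ?N H \<phi>).
        q \<otimes>\<^bsub>semidirect_product ?N H \<phi>\<^esub> p = \<one>\<^bsub>semidirect_product ?N H \<phi>\<^esub>"
      by blast
  qed (auto simp: semidirect_product_def \<phi>C \<phi>m \<phi>\<phi> \<phi>1 N.m_assoc H.m_assoc)
qed

corollary group_G_2_2: "group G_2_2"
  unfolding G_2_2_def by (intro group_restricted_wreath_product DirProd_group) auto

end

theory Submission
  imports Defs
begin

text \<open>
  The wreath product is modelled by pairs $(S, h)$ with a finite set $S \subseteq \mathbb{Z}^2$ of
  lit lamps and a translation $h$, where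
  $(S, h)(T, k) = (S \mathbin{\triangle} (h + T), h + k)$. The lamp at $u$ stands for
  $\xi^{u} \alpha \xi^{-u}$, so that $\alpha$, $\xi_1$, $\xi_2$ are the lamp at the origin and the
  two unit translations. This group acts on the tree by the virtual endomorphism
  $$f(S, (2k, n)) = (\{(b, (a + 1)/2) : (a, b) \in S,\ a \mbox{ odd}\},\ (n, k))$$
  on the subgroup of index 4 where $|S|$ and the first translation coordinate are even, with the
  coset representatives $\xi_1^{p} \alpha^{e}$ attached to the letters $e + 2p$. The resulting
  automorphisms satisfy the recursive equations, hence are the given ones.

  Passing to sections halves the quadratic form $a^2 + 2b^2$, on translations as well as on
  differences of two lamps. An element acting trivially therefore has trivial translation, and
  each of its lamps would eventually become the only lamp of a trivially acting section, which is
  impossible because such a section has an even number of lamps; so the action is faithful. The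
  same contraction keeps all sections of an element in a bounded box, which gives finiteness of the
  set of states. For $\xi_1$ the sections fill
  $\mathrm{Pow}\{(0,1), (1,1)\} \times \{(0,0), (1,0), (0,1)\}$, which has $4 \cdot 3$ elements.
\<close>

section \<open>Action of the lamp group on the tree\<close>

type_synonym lamp = "(int \<times> int) set \<times> int \<times> int"

definition lamp_carrier :: "lamp set" where
  "lamp_carrier = {g. finite (fst g)}"

fun lamp_mult :: "lamp \<Rightarrow> lamp \<Rightarrow> lamp" where
  "lamp_mult (S, m, n) (T, m', n') =
     ({(a, b). ((a, b) \<in> S) \<noteq> ((a - m, b - n) \<in> T)}, m + m', n + n')"

fun lamp_inv :: "lamp \<Rightarrow> lamp" where
  "lamp_inv (S, m, n) = ({(a, b). (a + m, b + n) \<in> S}, - m, - n)"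

text \<open>The letter \<open>i\<close> is read as the number with binary digits \<open>lo i\<close> and \<open>hi i\<close>; \<open>\<alpha>\<close> switches the
  former, \<open>\<xi>\<^sub>1\<close> the latter.\<close>

definition lo :: "4 \<Rightarrow> bool" where "lo i \<longleftrightarrow> i = 1 \<or> i = 3"
definition hi :: "4 \<Rightarrow> bool" where "hi i \<longleftrightarrow> i = 2 \<or> i = 3"

definition letter :: "bool \<Rightarrow> bool \<Rightarrow> 4" where
  "letter e p = (if e then (if p then 3 else 1) else (if p then 2 else 0))"

text \<open>The index-4 subgroup is the kernel of a map onto the Klein four-group. The parities of
  the number of lamps and of the first translation coordinate are the two coordinates of a
  coset.\<close>

fun perm :: "lamp \<Rightarrow> 4 \<Rightarrow> 4" where
  "perm (S, m, n) i = letter (lo i \<noteq> odd (card S)) (hi i \<noteq> odd m)"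

text \<open>With \<open>t\<^sub>i\<close> the coset representative of the letter \<open>i\<close>, the section of \<open>g\<close> at \<open>i\<close> is
  $f(t_i\, g\, t_j^{-1})$ for the image \<open>j\<close> of \<open>i\<close>. The three summands of the lamp set below come from
  \<open>t\<^sub>i\<close>, \<open>g\<close> and \<open>t\<^sub>j\<close>. The division rounds down by exactly the translation part of \<open>t\<^sub>j\<close>.\<close>

fun sect :: "lamp \<Rightarrow> 4 \<Rightarrow> lamp" where
  "sect (S, m, n) i =
     ({(c, d). (lo i \<and> (2 * d - 1, c) = (of_bool (hi i), 0)) \<noteq>
         (((2 * d - 1 - of_bool (hi i), c) \<in> S) \<noteq>
          (lo (perm (S, m, n) i) \<and> (2 * d - 1, c) = (of_bool (hi i) + m, n)))},
      n, (of_bool (hi i) + m) div 2)"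

fun act :: "lamp \<Rightarrow> vertex \<Rightarrow> vertex" where
  "act g [] = []"
| "act g (i # w) = perm g i # act (sect g i) w"

declare perm.simps [simp del] sect.simps [simp del]

lemma lo_letter [simp]: "lo (letter e p) = e" and hi_letter [simp]: "hi (letter e p) = p"
  by (simp_all add: lo_def hi_def letter_def)

lemma letter_lo_hi [simp]: "letter (lo i) (hi i) = i"
  using four_cases[of i] by (auto simp: lo_def hi_def letter_def)

section \<open>Finiteness and parity of lamp sets\<close>

lemma finite_lamp_mult:
  assumes "finite S" "finite T"
  shows "finite {(a, b). ((a, b) \<in> S) \<noteq> ((a - m, b - n) \<in> (T :: (int \<times> int) set))}"
proof (rule finite_subset)
  show "{(a, b). ((a, b) \<in> S) \<noteq> ((a - m, b - n) \<in> T)} \<subseteq> S \<union> (\<lambda>(a, b). (a + m, b + n)) ` T"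
    by (force simp: image_iff)
qed (use assms in simp)

lemma card_sym_diff_parity:
  assumes "finite S" "finite T"
  shows "odd (card (sym_diff S T)) \<longleftrightarrow> (odd (card S) \<noteq> odd (card T))"
proof -
  have "card S = card (S - T) + card (S \<inter> T)"
    using assms by (metis add.commute card_Int_Diff)
  moreover have "card T = card (T - S) + card (S \<inter> T)"
    using assms by (metis add.commute card_Int_Diff inf_commute)
  moreover have "card (sym_diff S T) = card (S - T) + card (T - S)"
    using assms by (intro card_Un_disjoint) auto
  ultimately show ?thesis by presburger
qed

text \<open>Translating \<open>T\<close> keeps its size, and each lamp common to both sets is lost
  twice. So the parity of the number of lamps is a homomorphism to Z/2.\<close>

lemma card_lamp_mult_parity:
  assumes "finite S" "finite T"
  shows "odd (card {(a, b). ((a, b) \<in> S) \<noteq> ((a - m, b - n) \<in> (T :: (int \<times> int) set))})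
    \<longleftrightarrow> (odd (card S) \<noteq> odd (card T))"
proof -
  let ?f = "\<lambda>(a, b). (a + m, b + n)"
  have "{(a, b). ((a, b) \<in> S) \<noteq> ((a - m, b - n) \<in> T)} = sym_diff S (?f ` T)"
    by (force simp: image_iff)
  moreover have "card (?f ` T) = card T"
    by (intro card_image inj_onI) auto
  ultimately show ?thesis
    using card_sym_diff_parity[of S "?f ` T"] assms by simp
qed

lemma lamp_mult_closed:
  "g \<in> lamp_carrier \<Longrightarrow> h \<in> lamp_carrier \<Longrightarrow> lamp_mult g h \<in> lamp_carrier"
  by (cases g; cases h)
    (simp only: lamp_carrier_def lamp_mult.simps mem_Collect_eq fst_conv finite_lamp_mult)

lemma lamp_inv_closed:
  assumes "g \<in> lamp_carrier" shows "lamp_inv g \<in> lamp_carrier"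
proof -
  obtain S m n where g: "g = (S, m, n)" by (cases g)
  have "{(a, b). (a + m, b + n) \<in> S} \<subseteq> (\<lambda>(a, b). (a - m, b - n)) ` S"
    by (force simp: image_iff)
  then show ?thesis
    using assms finite_subset unfolding g by (fastforce simp: lamp_carrier_def)
qed

lemma lamp_r_inv: "lamp_mult g (lamp_inv g) = ({}, 0, 0)"
  by (cases g) auto

lemma lamp_l_inv: "lamp_mult (lamp_inv g) g = ({}, 0, 0)"
  by (cases g) auto

lemma sect_closed:
  assumes "g \<in> lamp_carrier" shows "sect g i \<in> lamp_carrier"
proof -
  obtain S m n where g: "g = (S, m, n)" by (cases g)
  \<comment> \<open>Undoes (c, d) -> (2d - 1 - r, c) with r = \<open>of_bool (hi i)\<close>. The two
    inserted points are where the lamps of the coset representatives of \<open>i\<close> and of its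
    image can land.\<close>
  let ?f = "\<lambda>(a, b). (b, (a + 1 + of_bool (hi i)) div 2)"
  have "fst (sect g i) \<subseteq> insert (0, (of_bool (hi i) + 1) div 2)
      (insert (n, (of_bool (hi i) + m + 1) div 2) (?f ` S))"
  proof
    fix x assume "x \<in> fst (sect g i)"
    then obtain c d where x: "x = (c, d)" and "(2 * d - 1, c) = (of_bool (hi i), 0) \<or>
        (2 * d - 1 - of_bool (hi i), c) \<in> S \<or> (2 * d - 1, c) = (of_bool (hi i) + m, n)"
      by (cases x) (auto simp: g sect.simps)
    moreover have "(c, d) \<in> ?f ` S" if "(2 * d - 1 - of_bool (hi i), c) \<in> S"
      using that by (rule rev_image_eqI) simp
    ultimately show "x \<in> insert (0, (of_bool (hi i) + 1) div 2)
      (insert (n, (of_bool (hi i) + m + 1) div 2) (?f ` S))"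
      by auto
  qed
  then show ?thesis
    using assms finite_subset by (fastforce simp: g lamp_carrier_def)
qed

section \<open>The action is a homomorphism into the tree automorphisms\<close>

lemma perm_mult:
  assumes "g \<in> lamp_carrier" "h \<in> lamp_carrier"
  shows "perm (lamp_mult g h) i = perm h (perm g i)"
proof -
  obtain S m n T m' n' where [simp]: "g = (S, m, n)" "h = (T, m', n')"
    by (cases g; cases h)
  have "finite S" "finite T" using assms by (simp_all add: lamp_carrier_def)
  then show ?thesis
    unfolding \<open>g = _\<close> \<open>h = _\<close> lamp_mult.simps perm.simps card_lamp_mult_parity[OF \<open>finite S\<close> \<open>finite T\<close>]
    by (simp, intro arg_cong2[of _ _ _ _ letter]) auto
qed

text \<open>Cocycle identity: t_i g h t_k^-1 = (t_i g t_j^-1)(t_j h t_k^-1), where the two copies of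
  t_j cancel.\<close>

lemma sect_mult:
  assumes "g \<in> lamp_carrier" "h \<in> lamp_carrier"
  shows "sect (lamp_mult g h) i = lamp_mult (sect g i) (sect h (perm g i))"
proof -
  obtain S m n where g: "g = (S, m, n)" by (cases g)
  obtain T m' n' where h: "h = (T, m', n')" by (cases h)
  define j where "j = perm g i"
  define p where "p = (of_bool (hi i) :: int)"
  define q where "q = (of_bool (hi j) :: int)"
  define e where "e = (p + m) div 2"
  have "q = (p + m) mod 2"
    by (auto simp: p_def q_def j_def g perm.simps mod_2_eq_odd)
  \<comment> \<open>\<open>q\<close> is the translation of t_j and \<open>e\<close> that of the
    section. Shifting \<open>d\<close> by \<open>e\<close> moves the original lamp by 2e = p + m -
    q, which yields fact \<open>2\<close>.\<close>
  then have e: "p + m = q + 2 * e"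
    unfolding e_def by presburger
  define f where "f = lo (perm h j)"
  have f: "lo (perm (lamp_mult g h) i) = f"
    using perm_mult[OF assms] by (simp add: f_def j_def)
  have 1: "(p + (m + m')) div 2 = e + (q + m') div 2"
    using e by presburger
  have 2: "2 * (d - e) - 1 = q \<longleftrightarrow> 2 * d - 1 = p + m"
    "2 * (d - e) - 1 - q = 2 * d - 1 - p - m"
    "2 * (d - e) - 1 = q + m' \<longleftrightarrow> 2 * d - 1 = p + (m + m')" for d
    using e by presburger+
  have 3: "c - n = 0 \<longleftrightarrow> c = n" "c - n = n' \<longleftrightarrow> c = n + n'" for c by auto
  \<comment> \<open>\<open>A\<close>, \<open>B\<close>, \<open>D\<close>, \<open>E\<close> are the
    lamps of t_i, g, h, t_k. \<open>C\<close> is the lamp of t_j, which cancels.\<close>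
  have 4: "(A \<noteq> ((B \<noteq> D) \<noteq> E)) \<longleftrightarrow> ((A \<noteq> (B \<noteq> C)) \<noteq> (C \<noteq> (D \<noteq> E)))" for A B C D E
    by blast
  have "sect (lamp_mult g h) i = ({(c, d). (lo i \<and> (2 * d - 1, c) = (p, 0)) \<noteq>
      ((((2 * d - 1 - p, c) \<in> S) \<noteq> ((2 * d - 1 - p - m, c - n) \<in> T)) \<noteq>
       (f \<and> (2 * d - 1, c) = (p + (m + m'), n + n')))}, n + n', (p + (m + m')) div 2)"
    using f by (simp only: g h lamp_mult.simps sect.simps p_def[symmetric] mem_Collect_eq prod.case)
  moreover have "sect g i = ({(c, d). (lo i \<and> (2 * d - 1, c) = (p, 0)) \<noteq>
      (((2 * d - 1 - p, c) \<in> S) \<noteq> (lo j \<and> (2 * d - 1, c) = (p + m, n)))}, n, e)"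
    by (simp only: g sect.simps p_def[symmetric] e_def j_def)
  moreover have "sect h j = ({(c, d). (lo j \<and> (2 * d - 1, c) = (q, 0)) \<noteq>
      (((2 * d - 1 - q, c) \<in> T) \<noteq> (f \<and> (2 * d - 1, c) = (q + m', n')))}, n', (q + m') div 2)"
    by (simp only: h sect.simps q_def[symmetric] f_def)
  ultimately show ?thesis
    unfolding j_def[symmetric]
    by (simp only: lamp_mult.simps mem_Collect_eq prod.case prod.inject 1 2 3)
       (intro conjI refl Collect_cong prod.case_cong 4)
qed

lemma act_mult:
  assumes "g \<in> lamp_carrier" "h \<in> lamp_carrier"
  shows "act (lamp_mult g h) = act h \<circ> act g"
proof
  fix w show "act (lamp_mult g h) w = (act h \<circ> act g) w"
    using assms
    by (induction w arbitrary: g h) (simp_all add: perm_mult sect_mult sect_closed)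
qed

lemma perm_one [simp]: "perm ({}, 0, 0) i = i"
  by (simp add: perm.simps)

lemma sect_one [simp]: "sect ({}, 0, 0) i = ({}, 0, 0)"
  by (auto simp: sect.simps)

lemma act_one: "act ({}, 0, 0) = id"
proof
  show "act ({}, 0, 0) w = id w" for w by (induction w) simp_all
qed

lemma act_inv:
  assumes "g \<in> lamp_carrier"
  shows "act g (act (lamp_inv g) w) = w" "act (lamp_inv g) (act g w) = w"
  using act_mult[OF assms lamp_inv_closed[OF assms]] act_mult[OF lamp_inv_closed[OF assms] assms]
  by (simp_all add: lamp_r_inv lamp_l_inv act_one fun_eq_iff)

lemma child_act: "child v w \<Longrightarrow> child (act g v) (act g w)"
proof (induction v arbitrary: g w)
  case Nil
  then show ?case by (auto simp: child_def)
next
  case (Cons i v)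
  then show ?case by (cases w) (auto simp: child_Cons_iff)
qed

lemma act_closed:
  assumes "g \<in> lamp_carrier" shows "act g \<in> carrier tree_Aut"
proof (rule tree_AutI)
  show "bij (act g)"
    by (rule o_bij[of "act (lamp_inv g)"]) (simp_all add: fun_eq_iff act_inv[OF assms])
  \<comment> \<open>\<open>child_act\<close> gives one direction for every element; the converse
    applies it to the inverse.\<close>
  show "child (act g v) (act g w) \<longleftrightarrow> child v w" for v w
    by (metis act_inv(2)[OF assms] child_act)
qed

lemma state_at_act: "state_at (act g) i = act (sect g i)"
  by (auto simp: state_at_def)


section \<open>Faithfulness\<close>

text \<open>The coset representatives of the letters 0 and 2 carry no lamp, so these two sections
  merely sort the lamps by the parity of the first coordinate.\<close>

lemma act_eq_idD:
  assumes g: "(S, m, n) \<in> lamp_carrier" and id: "act (S, m, n) = id"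
  shows "even (card S)" "even m"
    "act ({(c, d). (2 * d - 1, c) \<in> S}, n, m div 2) = id"
    "act ({(c, d). (2 * d - 2, c) \<in> S}, n, m div 2) = id"
proof -
  have *: "perm (S, m, n) i = i \<and> act (sect (S, m, n) i) w = w" for i w
    using fun_cong[OF id, of "i # w"] by auto
  have p: "perm (S, m, n) i = i" and s: "act (sect (S, m, n) i) = id" for i
    using * by auto
  show *: "even (card S)" "even m"
    using p[of 0] by (auto simp: perm.simps letter_def lo_def hi_def split: if_splits)
  have "sect (S, m, n) 0 = ({(c, d). (2 * d - 1, c) \<in> S}, n, m div 2)"
    by (auto simp: sect.simps p lo_def hi_def)
  with s[of 0] show "act ({(c, d). (2 * d - 1, c) \<in> S}, n, m div 2) = id"
    by simp
  \<comment> \<open>As \<open>m\<close> is even, (1 + m) div 2 = m div 2.\<close>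
  have "sect (S, m, n) 2 = ({(c, d). (2 * d - 2, c) \<in> S}, n, m div 2)"
    using *(2) by (auto simp: sect.simps p lo_def hi_def)
  with s[of 2] show "act ({(c, d). (2 * d - 2, c) \<in> S}, n, m div 2) = id"
    by simp
qed

lemma finite_odd_even_part:
  assumes "finite S"
  shows "finite {(c, d). (2 * d - 1, c) \<in> (S :: (int \<times> int) set)}"
    "finite {(c, d). (2 * d - 2, c) \<in> S}"
proof -
  show "finite {(c, d). (2 * d - 1, c) \<in> S}"
    using finite_vimageI[of S "\<lambda>(c, d). (2 * d - 1, c)"] assms
    by (auto simp: inj_def vimage_def case_prod_unfold)
  show "finite {(c, d). (2 * d - 2, c) \<in> S}"
    using finite_vimageI[of S "\<lambda>(c, d). (2 * d - 2, c)"] assms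
    by (auto simp: inj_def vimage_def case_prod_unfold)
qed

text \<open>Infinite descent: the section at 0 also acts trivially and has translation (n, m/2),
  where the quadratic form takes exactly half its value.\<close>

lemma act_eq_id_translation:
  assumes "(S, m, n) \<in> lamp_carrier" "act (S, m, n) = id"
  shows "m = 0 \<and> n = 0"
  using assms
proof (induction "nat (m\<^sup>2 + 2 * n\<^sup>2)" arbitrary: S m n rule: less_induct)
  case less
  note * = act_eq_idD[OF less.prems]
  obtain k where k: "m = 2 * k" using *(2) by blast
  let ?S = "{(c, d). (2 * d - 1, c) \<in> S}"
  have fin: "(?S, n, k) \<in> lamp_carrier"
    using less.prems(1) finite_odd_even_part(1)[of S] by (simp add: lamp_carrier_def)
  have id: "act (?S, n, k) = id" using *(3) by (simp add: k)
  show ?case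
  proof (cases "m\<^sup>2 + 2 * n\<^sup>2 = 0")
    case True
    then show ?thesis by (simp add: add_nonneg_eq_0_iff)
  next
    case False
    moreover have "m\<^sup>2 + 2 * n\<^sup>2 = 2 * (n\<^sup>2 + 2 * k\<^sup>2)" by (simp add: k)
    moreover have "0 \<le> n\<^sup>2 + 2 * k\<^sup>2" by simp
    moreover have "nat y < nat x" if "x \<noteq> 0" "x = 2 * y" "0 \<le> y" for x y :: int
      using that by linarith
    ultimately have "nat (n\<^sup>2 + 2 * k\<^sup>2) < nat (m\<^sup>2 + 2 * n\<^sup>2)"
      by blast
    from less.hyps[OF this fin id] show ?thesis by (simp add: k)
  qed
qed

text \<open>The lamp (a, b) is followed through sections while the others of its parity class draw
  nearer. At distance 0 it is alone, contradicting the even number of lamps.\<close>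

lemma act_eq_id_bounded_lamps:
  assumes "(S, 0, 0) \<in> lamp_carrier" "act (S, 0, 0) = id" "(a, b) \<in> S"
    "\<And>a' b'. (a', b') \<in> S \<Longrightarrow> (a - a')\<^sup>2 + 2 * (b - b')\<^sup>2 \<le> int N"
  shows False
  using assms
proof (induction N arbitrary: S a b)
  case 0
  have "(a', b') = (a, b)" if "(a', b') \<in> S" for a' b'
  proof -
    have "(a - a')\<^sup>2 + 2 * (b - b')\<^sup>2 = 0"
      using "0.prems"(4)[OF that] by (simp add: antisym)
    then show ?thesis by (simp add: add_nonneg_eq_0_iff)
  qed
  then have "S \<subseteq> {(a, b)}" by (metis old.prod.exhaust singletonI subsetI)
  then have "S = {(a, b)}" using "0.prems"(3) by blast
  then show ?case using act_eq_idD(1)[OF "0.prems"(1,2)] by simp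
next
  case (Suc N)
  have fin: "finite S" using Suc.prems(1) by (simp add: lamp_carrier_def)
  note * = act_eq_idD(3,4)[OF Suc.prems(1,2), simplified]
  \<comment> \<open>The parity of \<open>a\<close> decides whether the section at 0 or at 2 retains
    this lamp, which moves to (b, d).\<close>
  have "\<exists>d. a = 2 * d - 1 \<or> a = 2 * d - 2" by presburger
  then obtain d where "a = 2 * d - 1 \<or> a = 2 * d - 2" ..
  then show ?case
  proof
    assume a: "a = 2 * d - 1"
    let ?S = "{(c, d). (2 * d - 1, c) \<in> S}"
    show False
    proof (rule Suc.IH[of ?S b d])
      show "(?S, 0, 0) \<in> lamp_carrier"
        using finite_odd_even_part(1)[OF fin] by (simp add: lamp_carrier_def)
      show "(b, d) \<in> ?S" using Suc.prems(3) by (simp add: a)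
      fix b' d' assume "(b', d') \<in> ?S"
      then have "(a - (2 * d' - 1))\<^sup>2 + 2 * (b - b')\<^sup>2 \<le> int (Suc N)"
        by (intro Suc.prems(4)) simp
      \<comment> \<open>Surviving lamps share the parity of \<open>a\<close>, so the form halves
        exactly; from 2X <= N + 1 follows X <= N.\<close>
      moreover have "(a - (2 * d' - 1))\<^sup>2 = 2 * (2 * (d - d')\<^sup>2)"
        by (simp add: a power2_eq_square algebra_simps)
      ultimately show "(b - b')\<^sup>2 + 2 * (d - d')\<^sup>2 \<le> int N" by linarith
    qed (rule *)
  next
    assume a: "a = 2 * d - 2"
    let ?S = "{(c, d). (2 * d - 2, c) \<in> S}"
    show False
    proof (rule Suc.IH[of ?S b d])
      show "(?S, 0, 0) \<in> lamp_carrier"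
        using finite_odd_even_part(2)[OF fin] by (simp add: lamp_carrier_def)
      show "(b, d) \<in> ?S" using Suc.prems(3) by (simp add: a)
      fix b' d' assume "(b', d') \<in> ?S"
      then have "(a - (2 * d' - 2))\<^sup>2 + 2 * (b - b')\<^sup>2 \<le> int (Suc N)"
        by (intro Suc.prems(4)) simp
      moreover have "(a - (2 * d' - 2))\<^sup>2 = 2 * (2 * (d - d')\<^sup>2)"
        by (simp add: a power2_eq_square algebra_simps)
      ultimately show "(b - b')\<^sup>2 + 2 * (d - d')\<^sup>2 \<le> int N" by linarith
    qed (rule *)
  qed
qed

lemma act_eq_id:
  assumes g: "g \<in> lamp_carrier" and id: "act g = id"
  shows "g = ({}, 0, 0)"
proof -
  obtain S m n where gS: "g = (S, m, n)" by (cases g)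
  have mn: "m = 0" "n = 0" using act_eq_id_translation[of S m n] g id by (simp_all add: gS)
  have "S = {}"
  proof (rule ccontr)
    assume "S \<noteq> {}"
    then obtain a b where ab: "(a, b) \<in> S" by fastforce
    \<comment> \<open>Any common bound for the finitely many distances from (a, b) starts the
      descent.\<close>
    let ?N = "\<lambda>(a', b'). nat ((a - a')\<^sup>2 + 2 * (b - b')\<^sup>2)"
    have "finite S" using g by (simp add: gS lamp_carrier_def)
    then have "?N v \<le> Max (?N ` S)" if "v \<in> S" for v using that by simp
    then have "(a - a')\<^sup>2 + 2 * (b - b')\<^sup>2 \<le> int (Max (?N ` S))" if "(a', b') \<in> S" for a' b'
      using that by fastforce
    moreover have "(S, 0, 0) \<in> lamp_carrier" "act (S, 0, 0) = id"
      using g id unfolding gS mn by blast+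
    ultimately show False
      using act_eq_id_bounded_lamps[of S a b "Max (?N ` S)"] ab by blast
  qed
  then show ?thesis by (simp add: gS mn)
qed

lemma inj_on_act: "inj_on act lamp_carrier"
proof (rule inj_onI)
  fix g h assume g: "g \<in> lamp_carrier" and h: "h \<in> lamp_carrier" and eq: "act g = act h"
  have "act (lamp_mult g (lamp_inv h)) = id"
    unfolding act_mult[OF g lamp_inv_closed[OF h]] eq by (simp add: fun_eq_iff act_inv[OF h])
  then have "lamp_mult g (lamp_inv h) = ({}, 0, 0)"
    by (intro act_eq_id lamp_mult_closed lamp_inv_closed g h)
  moreover obtain S m n T m' n' where gh: "g = (S, m, n)" "h = (T, m', n')"
    by (cases g; cases h)
  ultimately have S: "{(a, b). ((a, b) \<in> S) \<noteq> ((a - m + m', b - n + n') \<in> T)} = {}"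
      and mn: "m = m'" "n = n'"
    by simp_all
  have "(a, b) \<in> S \<longleftrightarrow> (a, b) \<in> T" for a b
    using equals0D[OF S, of "(a, b)"] by (simp add: mn)
  then show "g = h" by (auto simp: gh mn)
qed

section \<open>Transfer of tree products, inverses and recursions to lamp elements\<close>

lemma inv_act:
  assumes "g \<in> lamp_carrier" shows "inv\<^bsub>tree_Aut\<^esub> (act g) = act (lamp_inv g)"
  using assms
  by (intro group.inv_equality[OF group_tree_Aut] act_closed lamp_inv_closed)
    (simp_all add: tree_Aut_mult tree_Aut_one fun_eq_iff act_inv)

lemma mult_act:
  assumes "g \<in> lamp_carrier" "h \<in> lamp_carrier"
  shows "act g \<otimes>\<^bsub>tree_Aut\<^esub> act h = act (lamp_mult g h)"
  using assms by (simp add: tree_Aut_mult act_mult)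

lemma act_wreath_elt:
  "act g = wreath_elt (act (sect g 0)) (act (sect g 1)) (act (sect g 2)) (act (sect g 3)) (perm g)"
proof
  fix w show "act g w =
    wreath_elt (act (sect g 0)) (act (sect g 1)) (act (sect g 2)) (act (sect g 3)) (perm g) w"
    using four_cases[of "hd w"] by (cases w) auto
qed

lemma lamp_carrier_iff [simp]: "(S, m, n) \<in> lamp_carrier \<longleftrightarrow> finite S"
  by (simp add: lamp_carrier_def)

lemmas lamp_closed [simp] = lamp_inv_closed lamp_mult_closed sect_closed

lemma lo_hi_simps [simp]:
  "\<not> lo 0" "lo 1" "\<not> lo 2" "lo 3" "\<not> hi 0" "\<not> hi 1" "hi 2" "hi 3"
  by (simp_all add: lo_def hi_def)

lemma perm_alpha: "perm ({(0, 0)}, 0, 0) = transpose 0 1 \<circ> transpose 2 3"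
proof
  show "perm ({(0, 0)}, 0, 0) i = (transpose 0 1 \<circ> transpose 2 3) i" for i :: 4
    using four_cases[of i] by (auto simp: perm.simps letter_def transpose_def)
qed

lemma perm_xi1: "perm ({}, 1, 0) = transpose 0 2 \<circ> transpose 1 3"
proof
  show "perm ({}, 1, 0) i = (transpose 0 2 \<circ> transpose 1 3) i" for i :: 4
    using four_cases[of i] by (auto simp: perm.simps letter_def transpose_def)
qed

lemma perm_xi2: "perm ({}, 0, 1) = id"
  by (simp add: perm.simps fun_eq_iff)

section \<open>Generators and states\<close>
text \<open>Turns the evaluation of a concrete section into a pointwise parity question for linear
  arithmetic.\<close>

lemma sect_eqI:
  assumes "\<And>c d. (c, d) \<in> T \<longleftrightarrow> (lo i \<and> (2 * d - 1, c) = (of_bool (hi i), 0)) \<noteq>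
      (((2 * d - 1 - of_bool (hi i), c) \<in> S) \<noteq>
       (lo (perm (S, m, n) i) \<and> (2 * d - 1, c) = (of_bool (hi i) + m, n)))"
    and "k = (of_bool (hi i) + m) div 2"
  shows "sect (S, m, n) i = (T, n, k)"
proof -
  have "fst (sect (S, m, n) i) = T"
    using assms(1) unfolding sect.simps by auto
  then show ?thesis using assms(2) by (simp add: sect.simps)
qed

text \<open>With \<open>hi i\<close> false the lamp sits at an even position and is dropped; with
  \<open>hi i\<close> true it cancels against the lamp of a coset representative.\<close>

lemma sect_alpha: "sect ({(0, 0)}, 0, 0) i = ({}, 0, 0)"
  by (rule sect_eqI; auto simp: perm.simps; presburger)

text \<open>The first eight entries are the two recursive equations; the others lead to the
  remaining states of \<open>\<xi>\<^sub>1\<close>.\<close>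

lemma sect_table:
  "sect ({}, 1, 0) 0 = ({}, 0, 0)"
  "sect ({}, 1, 0) 1 = ({(0, 1)}, 0, 0)"
  "sect ({}, 1, 0) 2 = ({}, 0, 1)"
  "sect ({}, 1, 0) 3 = ({(0, 1)}, 0, 1)"
  "sect ({}, 0, 1) 0 = ({}, 1, 0)"
  "sect ({}, 0, 1) 1 = ({}, 1, 0)"
  "sect ({}, 0, 1) 2 = ({}, 1, 0)"
  "sect ({}, 0, 1) 3 = ({(0, 1), (1, 1)}, 1, 0)"
  "sect ({(0, 1)}, 0, 0) 2 = ({(0, 1), (1, 1)}, 0, 0)"
  "sect ({(0, 1), (1, 1)}, 1, 0) 0 = ({(1, 1)}, 0, 0)"
  "sect ({(0, 1), (1, 1)}, 1, 0) 2 = ({(1, 1)}, 0, 1)"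
  "sect ({(0, 1), (1, 1)}, 1, 0) 3 = ({(0, 1), (1, 1)}, 0, 1)"
  "sect ({(1, 1)}, 0, 1) 0 = ({(1, 1)}, 1, 0)"
  "sect ({(1, 1)}, 0, 1) 3 = ({(0, 1)}, 1, 0)"
  by (rule sect_eqI; auto simp: perm.simps; presburger)+

lemma lamp_mult_sets:
  "lamp_mult (S, m, n) ({}, m', n') = (S, m + m', n + n')"
  "lamp_mult ({}, m, n) ({(a, b)}, m', n') = ({(m + a, n + b)}, m + m', n + n')"
  "lamp_mult ({(a, b)}, 0, 0) (S, m, n) =
    (if (a, b) \<in> S then S - {(a, b)} else insert (a, b) S, m, n)"
  by auto

declare lamp_mult.simps [simp del] lamp_inv.simps [simp del]

lemma lamp_inv_translation [simp]: "lamp_inv ({}, m, n) = ({}, - m, - n)"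
  by (simp add: lamp_inv.simps)

lemma conj_by_act:
  assumes "g \<in> lamp_carrier" "h \<in> lamp_carrier"
  shows "conj_by tree_Aut (act g) (act h) = act (lamp_mult (lamp_mult (lamp_inv h) g) h)"
  using assms by (simp add: conj_by_def inv_act mult_act)

lemma act_alpha: "act ({(0, 0)}, 0, 0) = rooted_perm (transpose 0 1 \<circ> transpose 2 3)"
  by (subst act_wreath_elt) (simp add: sect_alpha act_one perm_alpha)

lemma act_xi1:
  "act ({}, 1, 0) = wreath_elt \<one>\<^bsub>tree_Aut\<^esub>
     (conj_by tree_Aut (act ({(0, 0)}, 0, 0)) (inv\<^bsub>tree_Aut\<^esub> (act ({}, 0, 1))))
     (act ({}, 0, 1))
     (conj_by tree_Aut (act ({(0, 0)}, 0, 0)) (inv\<^bsub>tree_Aut\<^esub> (act ({}, 0, 1)))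
       \<otimes>\<^bsub>tree_Aut\<^esub> act ({}, 0, 1))
     (transpose 0 2 \<circ> transpose 1 3)"
  by (subst act_wreath_elt)
    (simp add: sect_table act_one tree_Aut_one perm_xi1 inv_act conj_by_act mult_act lamp_mult_sets)

lemma act_xi2:
  "act ({}, 0, 1) = wreath_elt (act ({}, 1, 0)) (act ({}, 1, 0)) (act ({}, 1, 0))
     (conj_by tree_Aut (act ({(0, 0)}, 0, 0)) (inv\<^bsub>tree_Aut\<^esub> (act ({}, 0, 1)))
       \<otimes>\<^bsub>tree_Aut\<^esub> conj_by tree_Aut (act ({(0, 0)}, 0, 0))
         (inv\<^bsub>tree_Aut\<^esub> (act ({}, 1, 0)) \<otimes>\<^bsub>tree_Aut\<^esub> inv\<^bsub>tree_Aut\<^esub> (act ({}, 0, 1)))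
       \<otimes>\<^bsub>tree_Aut\<^esub> act ({}, 1, 0))
     id"
  by (subst act_wreath_elt)
    (simp add: sect_table perm_xi2 inv_act conj_by_act mult_act lamp_mult_sets)

section \<open>Generation by the origin lamp and the two unit translations\<close>

lemma lamp_carrier_generated:
  assumes gen: "({(0, 0)}, 0, 0) \<in> M" "({}, 1, 0) \<in> M" "({}, 0, 1) \<in> M"
    and mult: "\<And>g h. g \<in> M \<Longrightarrow> h \<in> M \<Longrightarrow> lamp_mult g h \<in> M"
    and inv: "\<And>g. g \<in> M \<Longrightarrow> lamp_inv g \<in> M"
  shows "lamp_carrier \<subseteq> M"
proof
  have one: "({}, 0, 0) \<in> M"
    using mult[OF gen(2) inv[OF gen(2)]] by (simp add: lamp_mult_sets)
  have m: "({}, m, 0) \<in> M" for m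
  proof (induction m rule: int_induct[of _ 0])
    case (step1 i)
    show ?case using mult[OF step1(2) gen(2)] by (simp add: lamp_mult_sets)
  next
    case (step2 i)
    show ?case using mult[OF step2(2) inv[OF gen(2)]] by (simp add: lamp_mult_sets)
  qed (rule one)
  have n: "({}, 0, n) \<in> M" for n
  proof (induction n rule: int_induct[of _ 0])
    case (step1 i)
    show ?case using mult[OF step1(2) gen(3)] by (simp add: lamp_mult_sets)
  next
    case (step2 i)
    show ?case using mult[OF step2(2) inv[OF gen(3)]] by (simp add: lamp_mult_sets)
  qed (rule one)
  have t: "({}, m, n) \<in> M" for m n
    using mult[OF m n] by (simp add: lamp_mult_sets)
  \<comment> \<open>Conjugating the origin lamp by the translation (a, b) moves it to (a,
    b).\<close>
  have l: "({(a, b)}, 0, 0) \<in> M" for a b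
    using mult[OF mult[OF t gen(1)] t, of a b "- a" "- b"] by (simp add: lamp_mult_sets)
  have s: "(S, 0, 0) \<in> M" if "finite S" for S
    using that
  proof (induction S)
    case (insert u S)
    obtain a b where "u = (a, b)" by (cases u)
    then have "lamp_mult ({u}, 0, 0) (S, 0, 0) = (insert u S, 0, 0)"
      using insert.hyps(2) by (simp add: lamp_mult_sets)
    then show ?case using mult[OF l insert.IH, of a b] by (simp add: \<open>u = (a, b)\<close>)
  qed (rule one)
  fix g assume "g \<in> lamp_carrier"
  then obtain S m n where "g = (S, m, n)" "finite S" by (cases g) simp
  then show "g \<in> M" using mult[OF s t, of S m n] by (simp add: lamp_mult_sets)
qed

lemma subgroup_act: "subgroup (act ` lamp_carrier) tree_Aut"
proof (rule group.subgroupI[OF group_tree_Aut])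
  show "act ` lamp_carrier \<subseteq> carrier tree_Aut" using act_closed by blast
  show "act ` lamp_carrier \<noteq> {}" using lamp_carrier_iff[of "{}"] by blast
qed (auto simp: inv_act mult_act)

lemma generate_act:
  "generate tree_Aut {act ({(0, 0)}, 0, 0), act ({}, 1, 0), act ({}, 0, 1)} = act ` lamp_carrier"
  (is "generate _ ?gen = _")
proof
  show "generate tree_Aut ?gen \<subseteq> act ` lamp_carrier"
    by (intro group.generate_subgroup_incl[OF group_tree_Aut _ subgroup_act]) auto
  have sub: "subgroup (generate tree_Aut ?gen) tree_Aut"
    by (intro group.generate_is_subgroup[OF group_tree_Aut]) (simp add: act_closed)
  \<comment> \<open>The preimage of the generated group contains the three generators and is closed
    under products and inverses.\<close>
  have "lamp_carrier \<subseteq> {g \<in> lamp_carrier. act g \<in> generate tree_Aut ?gen}"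
  proof (rule lamp_carrier_generated, goal_cases)
    case (4 g h)
    then show ?case using subgroup.m_closed[OF sub] by (simp flip: mult_act)
  next
    case (5 g)
    then show ?case using subgroup.m_inv_closed[OF sub] by (simp flip: inv_act)
  qed (auto intro: generate.incl)
  then show "act ` lamp_carrier \<subseteq> generate tree_Aut ?gen" by blast
qed

section \<open>States, bounded by sets of lamp elements closed under sections\<close>

lemma states_act:
  assumes "h \<in> states (act g)" "g \<in> A" and closed: "\<And>x j. x \<in> A \<Longrightarrow> sect x j \<in> A"
  shows "h \<in> act ` A"
  using assms(1,2)
proof (induction rule: states.induct)
  case (step h i)
  then obtain x where "x \<in> A" "h = act x" by blast
  then show ?case using closed[of x i] by (simp add: state_at_act)
qed simp

lemma finite_states_act:
  assumes "g \<in> lamp_carrier"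
  shows "finite (states (act g))"
proof -
  obtain S m n where g: "g = (S, m, n)" "finite S" using assms by (cases g) auto
  \<comment> \<open>The entry 2 makes the box stable: |2d - 1 - r| <= K with r in {0, 1} gives |d|
    <= K/2 + 1, which is at most K once K >= 2.\<close>
  define K where "K = Max ({2, \<bar>m\<bar>, \<bar>n\<bar>} \<union> (\<lambda>(a, b). max \<bar>a\<bar> \<bar>b\<bar>) ` S)"
  define B where "B = {- K..K} \<times> {- K..K}"
  define A where "A = Pow B \<times> B"
  have K: "k \<le> K" if "k \<in> {2, \<bar>m\<bar>, \<bar>n\<bar>} \<union> (\<lambda>(a, b). max \<bar>a\<bar> \<bar>b\<bar>) ` S" for k
    unfolding K_def using that g(2) by (intro Max_ge) auto
  have mem_B: "(a, b) \<in> B \<longleftrightarrow> \<bar>a\<bar> \<le> K \<and> \<bar>b\<bar> \<le> K" for a b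
    unfolding B_def mem_Times_iff by (simp add: abs_le_iff) linarith
  have mem_A: "(T, p, q) \<in> A \<longleftrightarrow> (\<forall>a b. (a, b) \<in> T \<longrightarrow> \<bar>a\<bar> \<le> K \<and> \<bar>b\<bar> \<le> K) \<and> \<bar>p\<bar> \<le> K \<and> \<bar>q\<bar> \<le> K"
    for T p q unfolding A_def mem_Times_iff Pow_iff fst_conv snd_conv mem_B subset_iff split_paired_All ..
  have "\<bar>m\<bar> \<le> K" "\<bar>n\<bar> \<le> K" "2 \<le> K" by (intro K; simp)+
  moreover have "max \<bar>a\<bar> \<bar>b\<bar> \<le> K" if "(a, b) \<in> S" for a b
    using that by (intro K UnI2 image_eqI[of _ _ "(a, b)"]) simp_all
  ultimately have "g \<in> A" and K2: "2 \<le> K"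
    unfolding g mem_A max.bounded_iff by blast+
  note this(1)
  moreover have "sect x i \<in> A" if "x \<in> A" for x i
  proof -
    obtain T p q where x: "x = (T, p, q)" by (cases x)
    define r where "r = (of_bool (hi i) :: int)"
    have r: "0 \<le> r" "r \<le> 1" by (simp_all add: r_def)
    have T: "\<bar>a\<bar> \<le> K \<and> \<bar>b\<bar> \<le> K" if "(a, b) \<in> T" for a b
      using that \<open>x \<in> A\<close> unfolding x mem_A by blast
    have pq: "\<bar>p\<bar> \<le> K" "\<bar>q\<bar> \<le> K" using \<open>x \<in> A\<close> unfolding x mem_A by blast+
    obtain U where U: "sect x i = (U, q, (r + p) div 2)" by (simp add: x sect.simps r_def)
    have "\<bar>c\<bar> \<le> K \<and> \<bar>d\<bar> \<le> K" if "(c, d) \<in> U" for c d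
    proof -
      \<comment> \<open>A lamp of the section stems from t_i, from \<open>T\<close> or from t_j. In
        the outer two cases 2d - 1 - r is 0 or p.\<close>
      have "(2 * d - 1, c) = (r, 0) \<or> (2 * d - 1 - r, c) \<in> T \<or> (2 * d - 1, c) = (r + p, q)"
        using that U by (auto simp: x sect.simps r_def)
      then have "\<bar>c\<bar> \<le> K" "\<bar>2 * d - 1 - r\<bar> \<le> K"
        using T r K2 pq unfolding prod.inject by (auto dest: T)
      then show ?thesis using r K2 by arith
    qed
    moreover have "\<bar>(r + p) div 2\<bar> \<le> K" using r pq K2 by linarith
    ultimately show ?thesis
      using pq unfolding U mem_A by blast
  qed
  ultimately have "states (act g) \<subseteq> act ` A" using states_act by blast
  then show ?thesis by (rule finite_subset) (simp add: A_def B_def)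
qed

lemma states_xi1:
  "states (act ({}, 1, 0)) = act ` (Pow {(0, 1), (1, 1)} \<times> {(0, 0), (1, 0), (0, 1)})"
  (is "?L = act ` ?X")
proof
  have "sect x i \<in> ?X" if "x \<in> ?X" for x i
  proof -
    obtain T p q where x: "x = (T, p, q)" by (cases x)
    have T: "T \<subseteq> {(0, 1), (1, 1)}" and pq: "(p, q) \<in> {(0, 0), (1, 0), (0, 1)}"
      using that by (simp_all add: x)
    have "(c, d) \<in> {(0, 1), (1, 1)}" if "(c, d) \<in> fst (sect x i)" for c d
    proof -
      define r where "r = (of_bool (hi i) :: int)"
      have r: "r = 0 \<or> r = 1" by (cases "hi i") (simp_all add: r_def)
      have "(2 * d - 1, c) = (r, 0) \<or> (2 * d - 1 - r, c) \<in> T \<or> (2 * d - 1, c) = (r + p, q)"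
        using that by (auto simp: x sect.simps r_def)
      moreover have "(a = 0 \<or> a = 1) \<and> b = 1" if "(a, b) \<in> T" for a b
        using subsetD[OF T that] by auto
      moreover have "p = 0 \<and> q = 0 \<or> p = 1 \<and> q = 0 \<or> p = 0 \<and> q = 1"
        using pq by simp
      ultimately have "2 * d - 1 = r \<and> c = 0 \<or>
          (2 * d - 1 - r = 0 \<or> 2 * d - 1 - r = 1) \<and> c = 1 \<or>
          (2 * d - 1 = r \<or> 2 * d - 1 = r + 1) \<and> (c = 0 \<or> c = 1)"
        unfolding prod.inject by (metis add.right_neutral)
      \<comment> \<open>In every case 2d lies between 1 + r and 2 + r or between 1 and 3, hence all
        lamps lie in the row d = 1.\<close>
      with r have "d = 1 \<and> (c = 0 \<or> c = 1)" by presburger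
      then show ?thesis by auto
    qed
    then have "fst (sect x i) \<subseteq> {(0, 1), (1, 1)}" by fastforce
    moreover have "snd (sect x i) \<in> {(0, 0), (1, 0), (0, 1)}"
      using pq by (auto simp: x sect.simps)
    ultimately show ?thesis by (cases "sect x i") simp
  qed
  then show "?L \<subseteq> act ` ?X"
    using states_act[of _ "({}, 1, 0)" ?X] by blast
  have s: "act (sect g i) \<in> ?L" if "act g \<in> ?L" for g i
    using states.step[OF that, of i] by (simp add: state_at_act)
  have a: "act ({}, 1, 0) \<in> ?L" by (rule states.self)
  \<comment> \<open>Paths starting at \<open>\<xi>\<^sub>1\<close> reach 1 + 4 + 2 + 3 + 2 = 12
    elements in \<open>a\<close> to \<open>e\<close>, which exhaust \<open>?X\<close>.\<close>
  note b = s[OF a, of 0] s[OF a, of 1] s[OF a, of 2] s[OF a, of 3]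
  note b = b[unfolded sect_table]
  note c = s[OF b(2), of 2] s[OF b(3), of 3]
  note c = c[unfolded sect_table]
  note d = s[OF c(2), of 0] s[OF c(2), of 2] s[OF c(2), of 3]
  note d = d[unfolded sect_table]
  note e = s[OF d(2), of 0] s[OF d(2), of 3]
  note e = e[unfolded sect_table]
  show "act ` ?X \<subseteq> ?L"
    using a b c d e by (auto simp: Pow_insert image_Un)
qed

text \<open>Faithfulness ensures that distinct lamp elements are distinct automorphisms.\<close>

lemma card_states_xi1: "card (states (act ({}, 1, 0))) = 12"
proof -
  let ?X = "Pow {(0, 1), (1, 1)} \<times> {(0, 0), (1, 0), (0, 1)} :: lamp set"
  have "?X \<subseteq> lamp_carrier"
    by (auto simp: lamp_carrier_def intro: finite_subset[of _ "{(0, 1), (1, 1)}"])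
  then have "card (act ` ?X) = card ?X"
    using inj_on_act by (intro card_image) (rule inj_on_subset)
  also have "\<dots> = 12" by (simp add: card_cartesian_product card_Pow)
  finally show ?thesis by (simp only: states_xi1)
qed

section \<open>Identification with the restricted wreath product\<close>
text \<open>The index set is the whole type, so the extensionality condition of the direct sum is
  vacuous.\<close>

lemma G_2_2_carrier:
  "(f, v) \<in> carrier G_2_2 \<longleftrightarrow> range f \<subseteq> {0, 1} \<and> finite {u. f u \<noteq> 0}"
proof -
  have "{0..<2} = {0, 1 :: int}" by auto
  then show ?thesis
    by (auto simp: G_2_2_def restricted_wreath_product_def semidirect_product_def
        carrier_sum_group carrier_integer_mod_group)
qed

lemma G_2_2_mult:
  "(f, m, n) \<otimes>\<^bsub>G_2_2\<^esub> (f', m', n') =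
    (\<lambda>(a, b). (f (a, b) + f' (a - m, b - n)) mod 2, m + m', n + n')"
  by (auto simp: G_2_2_def restricted_wreath_product_def semidirect_product_def fun_eq_iff
      algebra_simps)

definition lamp_of :: "(int \<times> int \<Rightarrow> int) \<times> (int \<times> int) \<Rightarrow> lamp" where
  "lamp_of = (\<lambda>(f, v). ({u. f u = 1}, v))"

text \<open>Addition of indicator functions modulo 2 is symmetric difference of supports.\<close>

lemma lamp_of_mult:
  assumes "p \<in> carrier G_2_2" "q \<in> carrier G_2_2"
  shows "lamp_of (p \<otimes>\<^bsub>G_2_2\<^esub> q) = lamp_mult (lamp_of p) (lamp_of q)"
proof -
  obtain f m n g m' n' where pq: "p = (f, m, n)" "q = (g, m', n')" by (cases p; cases q)
  have fg: "f u = 0 \<or> f u = 1" "g u = 0 \<or> g u = 1" for u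
    using assms by (auto simp: pq G_2_2_carrier)
  have "(f u + g v) mod 2 = 1 \<longleftrightarrow> (f u = 1) \<noteq> (g v = 1)" for u v
    using fg(1)[of u] fg(2)[of v] by auto
  then show ?thesis
    by (simp add: pq G_2_2_mult lamp_of_def lamp_mult.simps case_prod_unfold)
qed

lemma bij_betw_lamp_of: "bij_betw lamp_of (carrier G_2_2) lamp_carrier"
proof (rule bij_betw_byWitness[where f' = "\<lambda>(S, v). (\<lambda>u. of_bool (u \<in> S), v)"])
  show "\<forall>p\<in>carrier G_2_2. (\<lambda>(S, v). (\<lambda>u. of_bool (u \<in> S), v)) (lamp_of p) = p"
  proof
    fix p assume p: "p \<in> carrier G_2_2"
    obtain f v where fv: "p = (f, v)" by (cases p)
    have "f u = 0 \<or> f u = 1" for u using p by (auto simp: fv G_2_2_carrier)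
    then have "of_bool (f u = 1) = f u" for u by (metis of_bool_eq)
    then show "(\<lambda>(S, v). (\<lambda>u. of_bool (u \<in> S), v)) (lamp_of p) = p"
      by (simp add: fv lamp_of_def)
  qed
  show "\<forall>g\<in>lamp_carrier. lamp_of ((\<lambda>(S, v). (\<lambda>u. of_bool (u \<in> S), v)) g) = g"
    by (simp add: lamp_of_def case_prod_unfold)
  show "lamp_of ` carrier G_2_2 \<subseteq> lamp_carrier"
  proof
    fix g assume "g \<in> lamp_of ` carrier G_2_2"
    then obtain f v where fv: "(f, v) \<in> carrier G_2_2" "g = ({u. f u = 1}, v)"
      by (auto simp: lamp_of_def)
    have "{u. f u = 1} \<subseteq> {u. f u \<noteq> 0}" by auto
    then show "g \<in> lamp_carrier"
      using fv finite_subset by (cases v) (auto simp: G_2_2_carrier)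
  qed
  show "(\<lambda>(S, v). (\<lambda>u. of_bool (u \<in> S), v)) ` lamp_carrier \<subseteq> carrier G_2_2"
    by (auto simp: lamp_carrier_def G_2_2_carrier)
qed

lemma act_lamp_of_iso:
  assumes G: "G = tree_Aut\<lparr>carrier := act ` lamp_carrier\<rparr>"
  shows "act \<circ> lamp_of \<in> iso G_2_2 G"
proof (rule isoI)
  have mem: "lamp_of p \<in> lamp_carrier" if "p \<in> carrier G_2_2" for p
    using bij_betw_lamp_of that by (rule bij_betwE[THEN bspec])
  show "act \<circ> lamp_of \<in> hom G_2_2 G"
    by (rule homI) (auto simp: G mem lamp_of_mult mult_act)
  show "bij_betw (act \<circ> lamp_of) (carrier G_2_2) (carrier G)"
    using bij_betw_trans[OF bij_betw_lamp_of inj_on_imp_bij_betw[OF inj_on_act]] by (simp add: G)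
qed

section \<open>Identification of the given automorphisms and conclusion\<close>

theorem theorem5:
  fixes \<alpha> \<xi>\<^sub>1 \<xi>\<^sub>2 :: "vertex \<Rightarrow> vertex"
    and G :: "(vertex \<Rightarrow> vertex) monoid"
  assumes "\<alpha> \<in> carrier tree_Aut" "\<xi>\<^sub>1 \<in> carrier tree_Aut" "\<xi>\<^sub>2 \<in> carrier tree_Aut"
    and "\<alpha> = rooted_perm (transpose 0 1 \<circ> transpose 2 3)"
    and "\<xi>\<^sub>1 = wreath_elt \<one>\<^bsub>tree_Aut\<^esub>
                       (conj_by tree_Aut \<alpha> (inv\<^bsub>tree_Aut\<^esub> \<xi>\<^sub>2))
                       \<xi>\<^sub>2
                       (conj_by tree_Aut \<alpha> (inv\<^bsub>tree_Aut\<^esub> \<xi>\<^sub>2) \<otimes>\<^bsub>tree_Aut\<^esub> \<xi>\<^sub>2)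
                       (transpose 0 2 \<circ> transpose 1 3)"
    and "\<xi>\<^sub>2 = wreath_elt \<xi>\<^sub>1
                       \<xi>\<^sub>1
                       \<xi>\<^sub>1
                       (conj_by tree_Aut \<alpha> (inv\<^bsub>tree_Aut\<^esub> \<xi>\<^sub>2)
                         \<otimes>\<^bsub>tree_Aut\<^esub> conj_by tree_Aut \<alpha> (inv\<^bsub>tree_Aut\<^esub> \<xi>\<^sub>1 \<otimes>\<^bsub>tree_Aut\<^esub> inv\<^bsub>tree_Aut\<^esub> \<xi>\<^sub>2)
                         \<otimes>\<^bsub>tree_Aut\<^esub> \<xi>\<^sub>1)
                       id"
    and "G = subgroup_generated tree_Aut {\<alpha>, \<xi>\<^sub>1, \<xi>\<^sub>2}"
  shows "G \<cong> G_2_2 \<and> G = state_closure \<xi>\<^sub>1 \<and> finite_state G \<and> card (states \<xi>\<^sub>1) = 12"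
proof -
  let ?a = "({(0, 0)}, 0, 0) :: lamp" and ?x = "({}, 1, 0) :: lamp" and ?y = "({}, 0, 1) :: lamp"
  interpret group tree_Aut by (rule group_tree_Aut)
  have a: "\<alpha> = act ?a" by (simp add: assms(4) act_alpha)
  have "act ?x \<in> carrier tree_Aut" "act ?y \<in> carrier tree_Aut" by (simp_all add: act_closed)
  note act_gens = this act_xi1[folded a] act_xi2[folded a]
  have "p = q" if "\<exists>!p. P p" "P p" "P q" for P and p q :: "(vertex \<Rightarrow> vertex) \<times> (vertex \<Rightarrow> vertex)"
    using that by blast
  note unique = this
  \<comment> \<open>Both pairs solve the recursive equations, whose solution is unique.\<close>
  have "(\<xi>\<^sub>1, \<xi>\<^sub>2) = (act ?x, act ?y)"
    by (rule unique[OF recursive_equations_unique_solution(2)[OF assms(4)]])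
      (unfold prod.case, (intro conjI assms act_gens)+)
  then have x: "\<xi>\<^sub>1 = act ?x" and y: "\<xi>\<^sub>2 = act ?y" by simp_all
  have gen: "generate tree_Aut {\<alpha>, \<xi>\<^sub>1, \<xi>\<^sub>2} = act ` lamp_carrier"
    using generate_act by (simp add: a x y)
  have G: "G = tree_Aut\<lparr>carrier := act ` lamp_carrier\<rparr>"
    using assms(1-3,7) gen by (simp add: subgroup_generated_def)
  have st: "states \<xi>\<^sub>1 \<subseteq> act ` lamp_carrier"
    using states_act[of _ ?x lamp_carrier] x sect_closed by auto
  have st_carrier: "states \<xi>\<^sub>1 \<subseteq> carrier tree_Aut"
    using st act_closed by blast
  have "generate tree_Aut (states \<xi>\<^sub>1) = act ` lamp_carrier"
  proof
    show "generate tree_Aut (states \<xi>\<^sub>1) \<subseteq> act ` lamp_carrier"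
      by (rule generate_subgroup_incl[OF st subgroup_act])
    have sub: "subgroup (generate tree_Aut (states \<xi>\<^sub>1)) tree_Aut"
      by (rule generate_is_subgroup[OF st_carrier])
    have "act (S, v) \<in> generate tree_Aut (states \<xi>\<^sub>1)"
      if "S \<subseteq> {(0, 1), (1, 1)}" "v \<in> {(0, 0), (1, 0), (0, 1)}" for S v
      using that by (intro generate.incl) (auto simp: x states_xi1)
    then have s: "act ?x \<in> generate tree_Aut (states \<xi>\<^sub>1)" "act ?y \<in> generate tree_Aut (states \<xi>\<^sub>1)"
      "act ({(0, 1)}, 0, 0) \<in> generate tree_Aut (states \<xi>\<^sub>1)"
      by simp_all
    \<comment> \<open>\<open>\<alpha>\<close> is not among the twelve states; it is recovered from
      the state with the single lamp (0, 1), its conjugate by the inverse of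
      \<open>\<xi>\<^sub>2\<close>.\<close>
    have "act ?a = inv\<^bsub>tree_Aut\<^esub> (act ?y) \<otimes>\<^bsub>tree_Aut\<^esub> act ({(0, 1)}, 0, 0) \<otimes>\<^bsub>tree_Aut\<^esub> act ?y"
      by (simp add: inv_act mult_act lamp_mult_sets)
    also have "\<dots> \<in> generate tree_Aut (states \<xi>\<^sub>1)"
      by (intro subgroup.m_closed[OF sub] subgroup.m_inv_closed[OF sub] s)
    finally show "act ` lamp_carrier \<subseteq> generate tree_Aut (states \<xi>\<^sub>1)"
      unfolding gen[symmetric] using s
      by (intro generate_subgroup_incl[OF _ sub]) (simp add: a x y)
  qed
  then have "G = state_closure \<xi>\<^sub>1"
    using st_carrier by (simp add: G state_closure_def subgroup_generated_def Int_absorb1)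
  moreover have "G \<cong> G_2_2"
    using group.iso_sym[OF group_G_2_2] act_lamp_of_iso[OF G] by (auto simp: is_iso_def)
  moreover have "finite_state G"
    using finite_states_act by (auto simp: finite_state_def G)
  ultimately show ?thesis using card_states_xi1 by (simp add: x)
qed

end
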